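(* If $G$ is a Left dead end with more than one good option, then \[\ell(G)\leq\min\left\{\operatorname{race}(G),\ \ell(G')+1,\ |\mathcal{T}(G)|-1,\ \frac{\operatorname{flex}(G)+1}{2}\right\},\] where $G'$ ranges over all good options of $G$.
   Context: All games are short partizan combinatorial game forms; $G+H$ is the disjunctive sum; $\cong$ denotes identity of forms. Play is misère (a player unable to move wins). Misère outcome classes are ordered $\mathscr L>\mathscr P>\mathscr R$ and $\mathscr L>\mathscr N>\mathscr R$; $G\geq H$ means that for every game $X$ the misère outcome of $G+X$ is $\geq$ that of $H+X$, $G=H$ means $G\ge H$ and $H\ge G$, and $G>H$ means $G\ge H$ and $G\ne H$. A Left dead end is a game no subposition of which (including itself) has a Left option; its options are its Right options. An option $G'$ of $G$ is good if there is no option $G''$ of $G$ with $G'>G''$; "more than one good option" means at least two pairwise unequal good options. A run of length $k$ of $G$ is a sequence $(G_0,\dots,G_k)$ with $G_0\cong G$ and $G_{i+1}$ an option of $G_i$; it is terminal if $G_k\cong0=\{\cdot\mid\cdot\}$; $\mathcal{T}(G)$ is the set of lengths of terminal runs and $\operatorname{race}(G)=\min\mathcal{T}(G)$. Let $\overline0=0$, $\overline n=\{\cdot\mid\overline{n-1}\}$; integers are Left dead ends isomorphic to some $\overline n$. Flexibility: $\operatorname{flex}(G)=0$ if $G$ is an integer, otherwise $1+\max\operatorname{flex}(G')$ over options $G'$. An atom is a Left dead end $A\neq0$ such that $A=H+K$ with Left dead ends $H,K$ implies $H=0$ or $K=0$. A factorisation of $G$ is an expression $G=A_1+\dots+A_k$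 with atoms $A_i$, of length $k$; $\ell(G)$ is the length of a longest factorisation of $G$. *)

theory Defs
  imports Complex_Main "HOL-Library.FSet"
begin

text \<open>
  Short partizan game forms.  Since options form finite sets, identity of forms is HOL equality;
  equality of games modulo misere play is the separate relation \<open>\<approx>\<close> below.
\<close>

datatype game = Game (left_opts: "game fset") (right_opts: "game fset")

definition options :: "game \<Rightarrow> game fset" where
  "options G = left_opts G |\<union>| right_opts G"

definition option_rel :: "(game \<times> game) set" where
  "option_rel = {(G', G). G' |\<in>| options G}"

lemma option_rel_iff: "(G', G) \<in> option_rel \<longleftrightarrow> G' |\<in>| options G"
  by (simp add: option_rel_def)

lemma left_option_rel: "G' |\<in>| left_opts G \<Longrightarrow> (G', G) \<in> option_rel"
  and right_option_rel: "G' |\<in>| right_opts G \<Longrightarrow> (G', G) \<in> option_rel"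
  by (auto simp: option_rel_def options_def)

lemma wf_option_rel: "wf option_rel"
  unfolding wf_def
proof (intro allI impI)
  fix P :: "game \<Rightarrow> bool" and G
  assume *: "\<forall>x. (\<forall>y. (y, x) \<in> option_rel \<longrightarrow> P y) \<longrightarrow> P x"
  show "P G"
  proof (induction G)
    case (Game L R)
    then have "P G'" if "(G', Game L R) \<in> option_rel" for G'
      using that by (auto simp: option_rel_def options_def)
    with * show ?case by blast
  qed
qed


subsection \<open>Disjunctive sum\<close>

instantiation game :: "{zero, plus}"
begin

definition zero_game :: game where
  "0 = Game {||} {||}"

function plus_game :: "game \<Rightarrow> game \<Rightarrow> game" where
  "G + H = Game
     ((\<lambda>G'. G' + H) |`| left_opts G |\<union>| (\<lambda>H'. G + H') |`| left_opts H)
     ((\<lambda>G'. G' + H) |`| right_opts G |\<union>| (\<lambda>H'. G + H') |`| right_opts H)"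
  by pat_completeness auto
termination
  by (relation "option_rel <*lex*> option_rel")
     (auto simp: wf_option_rel intro: left_option_rel right_option_rel)

instance ..

end

declare plus_game.simps [simp del]

lemma left_opts_plus:
  "left_opts (G + H) = (\<lambda>G'. G' + H) |`| left_opts G |\<union>| (\<lambda>H'. G + H') |`| left_opts H"
  by (subst plus_game.simps) simp

lemma right_opts_plus:
  "right_opts (G + H) = (\<lambda>G'. G' + H) |`| right_opts G |\<union>| (\<lambda>H'. G + H') |`| right_opts H"
  by (subst plus_game.simps) simp

lemma game_add_commute: "G + H = H + (G::game)"
proof (induction G H rule: plus_game.induct)
  case (1 G H)
  have "(\<lambda>G'. G' + H) |`| left_opts G = (\<lambda>G'. H + G') |`| left_opts G"
    and "(\<lambda>H'. G + H') |`| left_opts H = (\<lambda>H'. H' + G) |`| left_opts H"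
    and "(\<lambda>G'. G' + H) |`| right_opts G = (\<lambda>G'. H + G') |`| right_opts G"
    and "(\<lambda>H'. G + H') |`| right_opts H = (\<lambda>H'. H' + G) |`| right_opts H"
    by (rule fset.map_cong[OF refl], erule 1)+
  then show ?case
    by (intro game.expand) (simp only: left_opts_plus right_opts_plus funion_commute)
qed

lemma game_add_0: "0 + G = (G::game)"
proof (induction G)
  case (Game L R)
  have "(\<lambda>G. 0 + G) |`| L = id |`| L" "(\<lambda>G. 0 + G) |`| R = id |`| R"
    by (rule fset.map_cong[OF refl], simp add: Game)+
  moreover have "left_opts 0 = {||}" "right_opts 0 = {||}"
    by (simp_all add: zero_game_def)
  ultimately show ?case
    by (intro game.expand) (simp add: left_opts_plus right_opts_plus)
qed

lemma game_add_assoc: "(G + H) + K = G + (H + (K::game))"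
proof -
  have "\<forall>G H K. x = (G, H, K) \<longrightarrow> (G + H) + K = G + (H + K)" for x :: "game \<times> game \<times> game"
  proof (induction x rule: wf_induct_rule[OF wf_lex_prod[OF wf_option_rel
        wf_lex_prod[OF wf_option_rel wf_option_rel]]])
    case (1 x)
    show ?case
    proof (intro allI impI)
      fix G H K assume x: "x = (G, H, K)"
      have G: "(G' + H) + K = G' + (H + K)" if "(G', G) \<in> option_rel" for G'
        using 1[of "(G', H, K)"] that x by simp
      have H: "(G + H') + K = G + (H' + K)" if "(H', H) \<in> option_rel" for H'
        using 1[of "(G, H', K)"] that x by simp
      have K: "(G + H) + K' = G + (H + K')" if "(K', K) \<in> option_rel" for K'
        using 1[of "(G, H, K')"] that x by simp
      note IH = G[OF left_option_rel] G[OF right_option_rel] H[OF left_option_rel]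
        H[OF right_option_rel] K[OF left_option_rel] K[OF right_option_rel]
      have "left_opts ((G + H) + K) = left_opts (G + (H + K))"
        by (auto simp: left_opts_plus fimage_funion fset.map_comp comp_def IH
             cong: fset.map_cong_simp)
      moreover have "right_opts ((G + H) + K) = right_opts (G + (H + K))"
        by (auto simp: right_opts_plus fimage_funion fset.map_comp comp_def IH
             cong: fset.map_cong_simp)
      ultimately show "(G + H) + K = G + (H + K)"
        by (intro game.expand) simp
    qed
  qed
  then show ?thesis by blast
qed

instance game :: comm_monoid_add
  by standard (rule game_add_assoc game_add_commute game_add_0)+


subsection \<open>Misere outcomes\<close>

text \<open>
  Under misere play a player who is to move and has no option wins.
\<close>

function left_wins_first :: "game \<Rightarrow> bool" and right_wins_first :: "game \<Rightarrow> bool" where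
  "left_wins_first G \<longleftrightarrow>
     left_opts G = {||} \<or> (\<exists>G' \<in> fset (left_opts G). \<not> right_wins_first G')"
| "right_wins_first G \<longleftrightarrow>
     right_opts G = {||} \<or> (\<exists>G' \<in> fset (right_opts G). \<not> left_wins_first G')"
  by pat_completeness auto
termination
  by (relation "inv_image option_rel (\<lambda>x. case x of Inl G \<Rightarrow> G | Inr G \<Rightarrow> G)")
     (auto simp: wf_option_rel intro: left_option_rel right_option_rel)

declare left_wins_first.simps [simp del] right_wins_first.simps [simp del]

datatype outcome = Left_wins | Previous_wins | Next_wins | Right_wins

text \<open>The outcomes \<open>Previous_wins\<close> and \<open>Next_wins\<close> are incomparable.\<close>

instantiation outcome :: order
begin

definition less_eq_outcome :: "outcome \<Rightarrow> outcome \<Rightarrow> bool" where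
  "x \<le> y \<longleftrightarrow> x = y \<or> x = Right_wins \<or> y = Left_wins"

definition less_outcome :: "outcome \<Rightarrow> outcome \<Rightarrow> bool" where
  "x < y \<longleftrightarrow> x \<le> y \<and> x \<noteq> (y::outcome)"

instance
  by standard (auto simp: less_eq_outcome_def less_outcome_def)

end

definition misere_outcome :: "game \<Rightarrow> outcome" where
  "misere_outcome G =
     (if left_wins_first G
      then (if right_wins_first G then Next_wins else Left_wins)
      else (if right_wins_first G then Right_wins else Previous_wins))"

definition game_ge :: "game \<Rightarrow> game \<Rightarrow> bool"  (infix "\<succeq>" 50) where
  "G \<succeq> H \<longleftrightarrow> (\<forall>X. misere_outcome (G + X) \<ge> misere_outcome (H + X))"

definition game_eq :: "game \<Rightarrow> game \<Rightarrow> bool"  (infix "\<approx>" 50) where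
  "G \<approx> H \<longleftrightarrow> G \<succeq> H \<and> H \<succeq> G"

definition game_gt :: "game \<Rightarrow> game \<Rightarrow> bool"  (infix "\<succ>" 50) where
  "G \<succ> H \<longleftrightarrow> G \<succeq> H \<and> \<not> G \<approx> H"


subsection \<open>Left dead ends, runs and flexibility\<close>

definition subposition :: "game \<Rightarrow> game \<Rightarrow> bool" where
  "subposition H G \<longleftrightarrow> (H, G) \<in> option_rel\<^sup>*"

definition left_dead_end :: "game \<Rightarrow> bool" where
  "left_dead_end G \<longleftrightarrow> (\<forall>H. subposition H G \<longrightarrow> left_opts H = {||})"

text \<open>
  Only meaningful for Left dead ends, where all options belong to Right, who prefers smaller games.
\<close>

definition good_option :: "game \<Rightarrow> game \<Rightarrow> bool" where
  "good_option G' G \<longleftrightarrow> G' |\<in>| options G \<and> \<not> (\<exists>G''. G'' |\<in>| options G \<and> G' \<succ> G'')"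

definition more_than_one_good_option :: "game \<Rightarrow> bool" where
  "more_than_one_good_option G \<longleftrightarrow>
     (\<exists>G' G''. good_option G' G \<and> good_option G'' G \<and> \<not> G' \<approx> G'')"

text \<open>A run of length \<open>k\<close> is a list of \<open>k + 1\<close> games.\<close>

definition is_run :: "game \<Rightarrow> nat \<Rightarrow> game list \<Rightarrow> bool" where
  "is_run G k Gs \<longleftrightarrow>
     length Gs = k + 1 \<and> Gs ! 0 = G \<and> (\<forall>i<k. Gs ! (i + 1) |\<in>| options (Gs ! i))"

definition terminal_lengths :: "game \<Rightarrow> nat set" where
  "terminal_lengths G = {k. \<exists>Gs. is_run G k Gs \<and> Gs ! k = 0}"

definition race :: "game \<Rightarrow> nat" where
  "race G = Min (terminal_lengths G)"

primrec integer_game :: "nat \<Rightarrow> game" where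
  "integer_game 0 = 0"
| "integer_game (Suc n) = Game {||} {|integer_game n|}"

definition is_integer :: "game \<Rightarrow> bool" where
  "is_integer G \<longleftrightarrow> (\<exists>n. G = integer_game n)"

function flex :: "game \<Rightarrow> nat" where
  "flex G = (if is_integer G then 0 else 1 + Max (flex ` fset (options G)))"
  by pat_completeness auto
termination
  by (relation option_rel) (auto simp: wf_option_rel option_rel_iff)

declare flex.simps [simp del]


subsection \<open>Factorisations\<close>

definition atom :: "game \<Rightarrow> bool" where
  "atom A \<longleftrightarrow> left_dead_end A \<and> \<not> A \<approx> 0 \<and>
     (\<forall>H K. left_dead_end H \<and> left_dead_end K \<and> A \<approx> H + K \<longrightarrow> H \<approx> 0 \<or> K \<approx> 0)"

text \<open>The empty list is allowed, so that \<open>0\<close> has the factorisation of length \<open>0\<close>.\<close>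

definition is_factorisation :: "game list \<Rightarrow> game \<Rightarrow> bool" where
  "is_factorisation As G \<longleftrightarrow> (\<forall>A \<in> set As. atom A) \<and> G \<approx> sum_list As"

text \<open>
  For a Left dead end the set of lengths is nonempty and finite: race is additive on Left dead ends,
  invariant under \<open>\<approx>\<close>, and positive on atoms.
\<close>

definition factorisation_length :: "game \<Rightarrow> nat"  ("\<ell>") where
  "factorisation_length G = Max {length As | As. is_factorisation As G}"

end

theory Submission
  imports Defs
begin

text \<open>
  On Left dead ends \<open>G \<succeq> H\<close> means that \<open>G\<close> and \<open>H\<close> are both zero or both nonzero and every option
  of \<open>G\<close> lies above some option of \<open>H\<close>.  Hence a run of \<open>G\<close> can be mirrored in \<open>H\<close>, so terminal
  lengths and flexibility are monotone and therefore invariant under equality, and every good option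
  of \<open>G\<close> equals an option of a given factorisation of \<open>G\<close>.  That option alters only one atom, which
  bounds \<open>\<ell> G\<close> by \<open>\<ell> G' + 1\<close>.

  All options of \<open>1 + H\<close> lie above \<open>H\<close>, so the atom \<open>1\<close> does not occur in a factorisation of a game
  with more than one good option.  Every other atom has at least two terminal lengths, and in
  particular one that is at least \<open>2\<close>.  As the set of terminal lengths of a sum is the sumset, each
  atom increases its cardinality by at least one.  Playing the atoms one after the other, each along
  a run of length at least \<open>2\<close>, gives the bound for the flexibility.
\<close>

subsection \<open>Left dead ends\<close>

lemma options_plus: "options (G + H) = (\<lambda>G'. G' + H) |`| options G |\<union>| (\<lambda>H'. G + H') |`| options H"
  by (auto simp: options_def left_opts_plus right_opts_plus)

lemma game_option_induct [case_names step]: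
  assumes "\<And>G. (\<And>G'. G' |\<in>| options G \<Longrightarrow> P G') \<Longrightarrow> P G"
  shows "P G"
  using wf_induct_rule[OF wf_option_rel, of P G] assms by (auto simp: option_rel_iff)

lemma options_zero [simp]: "options 0 = {||}" "left_opts 0 = {||}" "right_opts 0 = {||}"
  by (simp_all add: options_def zero_game_def)

lemma options_eq_empty_iff: "options G = {||} \<longleftrightarrow> G = 0"
  by (cases G) (auto simp: options_def zero_game_def)

lemma game_plus_eq_zero_iff [simp]: "G + H = 0 \<longleftrightarrow> G = 0 \<and> H = (0::game)"
  by (simp add: options_plus flip: options_eq_empty_iff)

lemma left_dead_end_rec:
  "left_dead_end G \<longleftrightarrow> left_opts G = {||} \<and> (\<forall>G'. G' |\<in>| options G \<longrightarrow> left_dead_end G')"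
proof
  assume "left_dead_end G"
  then show "left_opts G = {||} \<and> (\<forall>G'. G' |\<in>| options G \<longrightarrow> left_dead_end G')"
    unfolding left_dead_end_def subposition_def
    by (meson option_rel_iff rtrancl.rtrancl_into_rtrancl rtrancl.rtrancl_refl)
next
  assume *: "left_opts G = {||} \<and> (\<forall>G'. G' |\<in>| options G \<longrightarrow> left_dead_end G')"
  show "left_dead_end G"
    unfolding left_dead_end_def subposition_def
  proof (intro allI impI)
    fix H assume "(H, G) \<in> option_rel\<^sup>*"
    then show "left_opts H = {||}"
      by (cases rule: rtranclE)
        (use * in \<open>auto simp: left_dead_end_def subposition_def option_rel_iff\<close>)
  qed
qed

lemma left_dead_end_left_opts: "left_dead_end G \<Longrightarrow> left_opts G = {||}"
  and left_dead_end_option: "left_dead_end G \<Longrightarrow> G' |\<in>| options G \<Longrightarrow> left_dead_end G'"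
  using left_dead_end_rec by blast+

lemma left_dead_end_right_opts: "left_dead_end G \<Longrightarrow> right_opts G = options G"
  by (simp add: options_def left_dead_end_left_opts)

lemma left_dead_end_zero [simp]: "left_dead_end 0"
  by (subst left_dead_end_rec) simp

lemma left_dead_end_plus: "left_dead_end G \<Longrightarrow> left_dead_end H \<Longrightarrow> left_dead_end (G + H)"
proof (induction G arbitrary: H rule: game_option_induct)
  case G: (step G)
  from \<open>left_dead_end H\<close> show ?case
  proof (induction H rule: game_option_induct)
    case H: (step H)
    have "left_opts (G + H) = {||}"
      using G.prems(1) H.prems by (simp add: left_opts_plus left_dead_end_left_opts)
    moreover have "left_dead_end (G' + H)" if "G' |\<in>| options G" for G'
      using G that H.prems left_dead_end_option by blast
    moreover have "left_dead_end (G + H')" if "H' |\<in>| options H" for H'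
      using H that left_dead_end_option by blast
    ultimately show ?case by (subst left_dead_end_rec) (auto simp: options_plus)
  qed
qed

lemma left_dead_end_sum_list: "(\<And>A. A \<in> set As \<Longrightarrow> left_dead_end A) \<Longrightarrow> left_dead_end (sum_list As)"
  by (induction As) (auto intro: left_dead_end_plus)


subsection \<open>The order on Left dead ends\<close>

lemma misere_outcome_le_iff:
  "misere_outcome H \<le> misere_outcome G \<longleftrightarrow>
     (left_wins_first H \<longrightarrow> left_wins_first G) \<and> (right_wins_first G \<longrightarrow> right_wins_first H)"
  by (auto simp: misere_outcome_def less_eq_outcome_def)

section \<open>Preorder and congruence laws\<close>

lemma game_ge_refl [simp]: "G \<succeq> G"
  by (simp add: game_ge_def)

lemma game_ge_trans: "G \<succeq> H \<Longrightarrow> H \<succeq> K \<Longrightarrow> G \<succeq> K"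
  unfolding game_ge_def by (meson order_trans)

lemma game_ge_plus_right: "G \<succeq> H \<Longrightarrow> G + K \<succeq> H + K"
  unfolding game_ge_def by (metis add.assoc)

lemma game_eq_refl [simp]: "G \<approx> G"
  by (simp add: game_eq_def)

lemma game_eq_sym: "G \<approx> H \<Longrightarrow> H \<approx> G"
  by (simp add: game_eq_def)

lemma game_eq_trans: "G \<approx> H \<Longrightarrow> H \<approx> K \<Longrightarrow> G \<approx> K"
  unfolding game_eq_def by (meson game_ge_trans)

lemma game_eq_plus:
  assumes "G \<approx> G'" "H \<approx> H'"
  shows "G + H \<approx> G' + H'"
proof -
  have "G + H \<approx> G' + H" "H + G' \<approx> H' + G'"
    using assms game_ge_plus_right by (auto simp: game_eq_def)
  then show ?thesis
    by (metis add.commute game_eq_trans)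
qed

text \<open>Induction on the test game \<open>X\<close>. Left can move only in \<open>X\<close>, so
  her winning moves are copied there. A winning move of Right in \<open>X\<close> is copied too, and
  one to \<open>G'\<close> is replaced by the move to a smaller \<open>H'\<close>. If Right wins
  \<open>G + X\<close> for want of a move, then \<open>G\<close> is zero, and \<open>zero\<close>
  leaves him without a move in \<open>H + X\<close> as well.\<close>

lemma game_geI:
  assumes G: "left_dead_end G" and H: "left_dead_end H"
    and zero: "G = 0 \<Longrightarrow> H = 0"
    and opt: "\<And>G'. G' |\<in>| options G \<Longrightarrow> \<exists>H'. H' |\<in>| options H \<and> G' \<succeq> H'"
  shows "G \<succeq> H"
  unfolding game_ge_def misere_outcome_le_iff
proof (rule allI)
  fix X
  show "(left_wins_first (H + X) \<longrightarrow> left_wins_first (G + X)) \<and>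
        (right_wins_first (G + X) \<longrightarrow> right_wins_first (H + X))"
  proof (induction X rule: game_option_induct)
    case (step X)
    have L: "left_opts (G + X) = (\<lambda>X'. G + X') |`| left_opts X"
        "left_opts (H + X) = (\<lambda>X'. H + X') |`| left_opts X"
      using G H by (simp_all add: left_opts_plus left_dead_end_left_opts)
    have R: "right_opts (G + X) = (\<lambda>G'. G' + X) |`| options G |\<union>| (\<lambda>X'. G + X') |`| right_opts X"
        "right_opts (H + X) = (\<lambda>H'. H' + X) |`| options H |\<union>| (\<lambda>X'. H + X') |`| right_opts X"
      using G H by (simp_all add: right_opts_plus left_dead_end_right_opts)
    have lw: "left_wins_first (G + X)" if "left_wins_first (H + X)"
    proof -
      from that consider "left_opts X = {||}"
        | X' where "X' |\<in>| left_opts X" "\<not> right_wins_first (H + X')"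
        by (auto simp: left_wins_first.simps[of "H + X"] L)
      then show ?thesis
      proof cases
        case 1
        then show ?thesis by (simp add: left_wins_first.simps[of "G + X"] L)
      next
        case 2
        then have "\<not> right_wins_first (G + X')"
          using step[of X'] by (auto simp: options_def)
        with 2 show ?thesis by (auto simp: left_wins_first.simps[of "G + X"] L)
      qed
    qed
    have rw: "right_wins_first (H + X)" if "right_wins_first (G + X)"
    proof -
      from that consider "options G = {||}" "right_opts X = {||}"
        | G' where "G' |\<in>| options G" "\<not> left_wins_first (G' + X)"
        | X' where "X' |\<in>| right_opts X" "\<not> left_wins_first (G + X')"
        by (auto simp: right_wins_first.simps[of "G + X"] R)
      then show ?thesis
      proof cases
        case 1
        then have "H = 0" using zero by (simp add: options_eq_empty_iff)
        with 1 show ?thesis by (simp add: right_wins_first.simps[of X])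
      next
        case 2
        then obtain H' where "H' |\<in>| options H" "G' \<succeq> H'" using opt by blast
        moreover from this 2 have "\<not> left_wins_first (H' + X)"
          by (auto simp: game_ge_def misere_outcome_le_iff)
        ultimately show ?thesis by (auto simp: right_wins_first.simps[of "H + X"] R)
      next
        case 3
        then have "\<not> left_wins_first (H + X')"
          using step[of X'] by (auto simp: options_def)
        with 3 show ?thesis by (auto simp: right_wins_first.simps[of "H + X"] R)
      qed
    qed
    from lw rw show ?case by blast
  qed
qed

section \<open>Necessity of the recursive test for the order\<close>

primrec left_moves :: "nat \<Rightarrow> game" where
  "left_moves 0 = 0"
| "left_moves (Suc n) = Game {|left_moves n|} {||}"

text \<open>With enough spare moves for Left, Right exhausts the Left dead end first.\<close>

lemma ex_right_wins_first_left_moves: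
  assumes "left_dead_end G"
  shows "\<exists>n. right_wins_first (G + left_moves n)"
  using assms
proof (induction G rule: game_option_induct)
  case (step G)
  show ?case
  proof (cases "G = 0")
    case True
    then have "right_wins_first (G + left_moves 0)" by (simp add: right_wins_first.simps)
    then show ?thesis ..
  next
    case False
    then obtain G' where G': "G' |\<in>| options G" using options_eq_empty_iff by blast
    then obtain n where n: "right_wins_first (G' + left_moves n)"
      using step left_dead_end_option by blast
    have "left_opts G' = {||}" using step.prems G' left_dead_end_option left_dead_end_left_opts by blast
    then have "\<not> left_wins_first (G' + left_moves (Suc n))"
      using n by (subst left_wins_first.simps) (auto simp: left_opts_plus)
    then have "right_wins_first (G + left_moves (Suc n))"
      using G' step.prems
      by (subst right_wins_first.simps) (auto simp: right_opts_plus left_dead_end_right_opts)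
    then show ?thesis ..
  qed
qed

text \<open>Restricting the comparison to Right moving first makes every failure yield a witness of
  one fixed kind, and such witnesses can be combined into a single distinguishing game. On Left dead
  ends nothing is lost: see \<open>right_ge_imp_game_ge\<close>.\<close>

definition right_ge :: "game \<Rightarrow> game \<Rightarrow> bool" where
  "right_ge G H \<longleftrightarrow> (\<forall>X. right_wins_first (G + X) \<longrightarrow> right_wins_first (H + X))"

lemma game_ge_imp_right_ge: "G \<succeq> H \<Longrightarrow> right_ge G H"
  by (auto simp: right_ge_def game_ge_def misere_outcome_le_iff)

lemma right_ge_zero:
  assumes G: "left_dead_end G" and H: "left_dead_end H" and ge: "right_ge G H"
  shows "G = 0 \<longleftrightarrow> H = 0"
proof
  assume "G = 0"
  then have "right_wins_first (G + 0)" by (simp add: right_wins_first.simps)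
  with ge have "right_wins_first (H + 0)" unfolding right_ge_def by blast
  \<comment> \<open>Left has no move in \<open>H'\<close> and therefore wins it, so Right can win a
    Left dead end moving first only by having no move himself.\<close>
  moreover have "left_wins_first H'" if "H' |\<in>| options H" for H'
    using that H by (subst left_wins_first.simps) (meson left_dead_end_option left_dead_end_left_opts)
  ultimately show "H = 0"
    using H by (simp add: right_wins_first.simps[of H] left_dead_end_right_opts options_eq_empty_iff)
next
  assume "H = 0"
  show "G = 0"
  proof (rule ccontr)
    assume "G \<noteq> 0"
    then obtain G' where G': "G' |\<in>| options G" using options_eq_empty_iff by blast
    then obtain n where n: "right_wins_first (G' + left_moves n)"
      using G ex_right_wins_first_left_moves left_dead_end_option by blast
    \<comment> \<open>In \<open>X\<close> alone Right must move to \<open>0\<close>, where Left wins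
      for want of a move. In \<open>G + X\<close> he plays to \<open>G'\<close> instead, and Left's
      only reply leaves \<open>G' + left_moves n\<close>, which Right wins.\<close>
    define X where "X = Game {|left_moves n|} {|0|}"
    have "left_wins_first 0" by (simp add: left_wins_first.simps)
    then have "\<not> right_wins_first X"
      by (subst right_wins_first.simps) (auto simp: X_def)
    moreover have "\<not> left_wins_first (G' + X)"
      using n left_dead_end_left_opts[OF left_dead_end_option[OF G G']]
      by (subst left_wins_first.simps) (auto simp: left_opts_plus X_def)
    then have "right_wins_first (G + X)"
      using G' G
      by (subst right_wins_first.simps) (auto simp: right_opts_plus left_dead_end_right_opts)
    ultimately show False using ge \<open>H = 0\<close> by (auto simp: right_ge_def)
  qed
qed

text \<open>If no option \<open>H'\<close> of \<open>H\<close> lies below \<open>G'\<close>, say as witnessed by \<open>X H'\<close>, then Right, moving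
  first, wins \<open>G + Y\<close> but loses \<open>H + Y\<close> where \<open>Y\<close> has the Left options \<open>X H'\<close> and no Right option.\<close>

lemma right_ge_option:
  assumes G: "left_dead_end G" and H: "left_dead_end H" and ge: "right_ge G H"
    and G': "G' |\<in>| options G"
  shows "\<exists>H'. H' |\<in>| options H \<and> right_ge G' H'"
proof (rule ccontr)
  assume "\<not> ?thesis"
  then have "\<forall>H'. \<exists>X. H' |\<in>| options H \<longrightarrow>
      right_wins_first (G' + X) \<and> \<not> right_wins_first (H' + X)"
    by (auto simp: right_ge_def)
  then obtain X where X: "H' |\<in>| options H \<Longrightarrow> right_wins_first (G' + X H')"
      "H' |\<in>| options H \<Longrightarrow> \<not> right_wins_first (H' + X H')" for H'
    by metis
  define Y where "Y = Game (X |`| options H) {||}"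
  \<comment> \<open>This gives Left a move in \<open>Y\<close>, so that she does not win
    \<open>G' + Y\<close> by being stuck, and gives Right a move in \<open>H + Y\<close>, so that he
    does not win there by being stuck.\<close>
  have "options H \<noteq> {||}"
    using right_ge_zero[OF G H ge] G' by (auto simp: options_eq_empty_iff)
  have "\<not> left_wins_first (G' + Y)"
    using X(1) \<open>options H \<noteq> {||}\<close> left_dead_end_left_opts[OF left_dead_end_option[OF G G']]
    by (subst left_wins_first.simps) (auto simp: left_opts_plus Y_def)
  then have "right_wins_first (G + Y)"
    using G' G
    by (subst right_wins_first.simps) (auto simp: right_opts_plus left_dead_end_right_opts)
  moreover have "left_wins_first (H' + Y)" if "H' |\<in>| options H" for H'
    using X(2)[OF that] that
    by (subst left_wins_first.simps) (auto simp: left_opts_plus Y_def)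
  then have "\<not> right_wins_first (H + Y)"
    using \<open>options H \<noteq> {||}\<close> H
    by (subst right_wins_first.simps) (auto simp: right_opts_plus left_dead_end_right_opts Y_def)
  ultimately show False using ge by (auto simp: right_ge_def)
qed

text \<open>\<open>right_ge_zero\<close> and \<open>right_ge_option\<close> supply, recursively,
  exactly the premises of \<open>game_geI\<close>.\<close>

lemma right_ge_imp_game_ge:
  assumes "left_dead_end G" "left_dead_end H" "right_ge G H"
  shows "G \<succeq> H"
  using assms
proof (induction G arbitrary: H rule: game_option_induct)
  case (step G)
  show ?case
  proof (rule game_geI)
    show "\<exists>H'. H' |\<in>| options H \<and> G' \<succeq> H'" if "G' |\<in>| options G" for G'
      using right_ge_option[OF step.prems that] step that left_dead_end_option by meson
  qed (use step.prems right_ge_zero in blast)+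
qed

lemma game_ge_zero_iff:
  assumes "left_dead_end G" "left_dead_end H" "G \<succeq> H"
  shows "G = 0 \<longleftrightarrow> H = 0"
  using assms right_ge_zero game_ge_imp_right_ge by blast

lemma game_ge_option:
  assumes "left_dead_end G" "left_dead_end H" "G \<succeq> H" "G' |\<in>| options G"
  obtains H' where "H' |\<in>| options H" "G' \<succeq> H'"
  using assms right_ge_option game_ge_imp_right_ge right_ge_imp_game_ge left_dead_end_option
  by meson

lemma game_eq_zero_iff: "left_dead_end G \<Longrightarrow> G \<approx> 0 \<longleftrightarrow> G = 0"
  using game_ge_zero_iff[of G 0] by (auto simp: game_eq_def)


subsection \<open>Good options\<close>

lemma good_option_option: "good_option G' G \<Longrightarrow> G' |\<in>| options G"
  by (simp add: good_option_def)

text \<open>Pass from \<open>G'\<close> down to an option \<open>H'\<close> of \<open>H\<close>. Any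
  option of \<open>H\<close> below \<open>G'\<close> lies in turn above an option of
  \<open>G\<close>, which equals \<open>G'\<close> because \<open>G'\<close> is good; so everything
  in between equals \<open>G'\<close>. This makes \<open>H'\<close> both equal to \<open>G'\<close>
  and minimal.\<close>

lemma good_option_eq:
  assumes G: "left_dead_end G" and H: "left_dead_end H" and eq: "G \<approx> H"
    and good: "good_option G' G"
  obtains H' where "good_option H' H" "G' \<approx> H'"
proof -
  have GH: "G \<succeq> H" and HG: "H \<succeq> G" using eq by (simp_all add: game_eq_def)
  have G': "G' |\<in>| options G" using good by (rule good_option_option)
  obtain H' where H': "H' |\<in>| options H" "G' \<succeq> H'" using game_ge_option[OF G H GH G'] .
  have below: "G' \<approx> G''" if "G'' |\<in>| options G" "G' \<succeq> G''" for G''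
    using good that by (auto simp: good_option_def game_gt_def)
  have below_H: "G' \<approx> K" if K: "K |\<in>| options H" "G' \<succeq> K" for K
  proof -
    obtain G'' where "G'' |\<in>| options G" "K \<succeq> G''" using game_ge_option[OF H G HG K(1)] .
    with K below show ?thesis unfolding game_eq_def by (meson game_ge_trans)
  qed
  have "good_option H' H"
    unfolding good_option_def game_gt_def
    using H' below_H by (metis game_eq_sym game_eq_trans game_ge_trans)
  with that below_H H' show ?thesis by blast
qed

lemma more_than_one_good_option_eq:
  assumes "left_dead_end G" "left_dead_end H" "G \<approx> H" "more_than_one_good_option G"
  shows "more_than_one_good_option H"
proof -
  obtain X Y where "good_option X G" "good_option Y G" "\<not> X \<approx> Y"
    using assms(4) by (auto simp: more_than_one_good_option_def)
  then show ?thesis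
    unfolding more_than_one_good_option_def
    by (metis good_option_eq[OF assms(1-3)] game_eq_sym game_eq_trans)
qed

section \<open>Integers as forms and the summand 1\<close>

lemma integer_game_Suc_ne_zero [simp]: "integer_game (Suc n) \<noteq> 0"
  by (simp add: zero_game_def)

lemma options_integer_game_Suc [simp]:
  "left_opts (integer_game (Suc n)) = {||}"
  "right_opts (integer_game (Suc n)) = {|integer_game n|}"
  "options (integer_game (Suc n)) = {|integer_game n|}"
  by (simp_all add: options_def)

declare integer_game.simps(2) [simp del]

lemma left_dead_end_integer_game: "left_dead_end (integer_game n)"
proof (induction n)
  case (Suc n)
  then show ?case by (subst left_dead_end_rec) auto
qed simp

text \<open>Spending the \<open>1\<close> in \<open>1 + H'\<close> leads to \<open>H'\<close>,
  itself an option of \<open>H\<close>; any other option \<open>1 + H''\<close> lies above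
  \<open>H'\<close> by induction.\<close>

lemma one_plus_option_ge:
  assumes "left_dead_end H" "H' |\<in>| options H"
  shows "integer_game 1 + H' \<succeq> H"
  using assms
proof (induction H arbitrary: H' rule: game_option_induct)
  case (step H)
  have H': "left_dead_end H'" using step.prems left_dead_end_option by blast
  show ?case
  proof (rule game_geI)
    fix K assume "K |\<in>| options (integer_game 1 + H')"
    then consider "K = H'" | H'' where "H'' |\<in>| options H'" "K = integer_game 1 + H''"
      by (auto simp: options_plus)
    then show "\<exists>H'. H' |\<in>| options H \<and> K \<succeq> H'"
      using step H' by cases auto
  qed (use step.prems H' in \<open>auto intro: left_dead_end_plus left_dead_end_integer_game\<close>)
qed

text \<open>Spending the \<open>1\<close> leaves \<open>H\<close>, and by the previous lemma every
  other option lies above it.\<close>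

lemma good_option_one_plus:
  assumes H: "left_dead_end H" and good: "good_option X (integer_game 1 + H)"
  shows "X \<approx> H"
proof -
  have "X |\<in>| options (integer_game 1 + H)" using good by (rule good_option_option)
  then consider "X = H" | H' where "H' |\<in>| options H" "X = integer_game 1 + H'"
    by (auto simp: options_plus)
  then show ?thesis
  proof cases
    case 2
    then have "X \<succeq> H" using one_plus_option_ge[OF H] by blast
    moreover have "H |\<in>| options (integer_game 1 + H)" by (auto simp: options_plus)
    ultimately show ?thesis using good by (auto simp: good_option_def game_gt_def)
  qed simp
qed

lemma not_more_than_one_good_option_one_plus:
  "left_dead_end H \<Longrightarrow> \<not> more_than_one_good_option (integer_game 1 + H)"
  unfolding more_than_one_good_option_def
  by (metis good_option_one_plus game_eq_sym game_eq_trans)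


subsection \<open>Terminal lengths\<close>

lemma is_run_Suc_iff:
  "is_run G (Suc k) Gs \<longleftrightarrow> (\<exists>G' Gs'. Gs = G # Gs' \<and> G' |\<in>| options G \<and> is_run G' k Gs')"
proof
  assume run: "is_run G (Suc k) Gs"
  then obtain Gs' where Gs: "Gs = G # Gs'"
    by (cases Gs) (auto simp: is_run_def)
  have "Gs' ! 0 |\<in>| options G"
    using run unfolding is_run_def Gs by (auto dest: spec[of _ 0])
  moreover have "is_run (Gs' ! 0) k Gs'"
    using run unfolding is_run_def Gs by force
  ultimately show "\<exists>G' Gs'. Gs = G # Gs' \<and> G' |\<in>| options G \<and> is_run G' k Gs'"
    using Gs by blast
next
  assume "\<exists>G' Gs'. Gs = G # Gs' \<and> G' |\<in>| options G \<and> is_run G' k Gs'"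
  then show "is_run G (Suc k) Gs"
    by (auto simp: is_run_def nth_Cons split: nat.split)
qed

lemma zero_in_terminal_lengths: "0 \<in> terminal_lengths G \<longleftrightarrow> G = 0"
proof -
  have "is_run G 0 Gs \<longleftrightarrow> Gs = [G]" for Gs
    by (auto simp: is_run_def length_Suc_conv)
  then show ?thesis by (simp add: terminal_lengths_def)
qed

lemma Suc_in_terminal_lengths:
  "Suc k \<in> terminal_lengths G \<longleftrightarrow> (\<exists>G'. G' |\<in>| options G \<and> k \<in> terminal_lengths G')"
proof
  assume "\<exists>G'. G' |\<in>| options G \<and> k \<in> terminal_lengths G'"
  then obtain G' Gs where "G' |\<in>| options G" "is_run G' k Gs" "Gs ! k = 0"
    by (auto simp: terminal_lengths_def)
  then have "is_run G (Suc k) (G # Gs)" "(G # Gs) ! Suc k = 0"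
    by (auto simp: is_run_Suc_iff)
  then show "Suc k \<in> terminal_lengths G"
    unfolding terminal_lengths_def by blast
next
  assume "Suc k \<in> terminal_lengths G"
  then show "\<exists>G'. G' |\<in>| options G \<and> k \<in> terminal_lengths G'"
    by (fastforce simp: terminal_lengths_def is_run_Suc_iff)
qed

lemma terminal_lengths_zero [simp]: "terminal_lengths 0 = {0}"
proof -
  have "k \<in> terminal_lengths 0 \<longleftrightarrow> k = 0" for k
    by (cases k) (simp_all add: zero_in_terminal_lengths Suc_in_terminal_lengths)
  then show ?thesis by blast
qed

lemma terminal_lengths_rec:
  "G \<noteq> 0 \<Longrightarrow> terminal_lengths G = (\<Union>G' \<in> fset (options G). Suc ` terminal_lengths G')"
proof (rule set_eqI)
  fix k assume "G \<noteq> 0"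
  then show "k \<in> terminal_lengths G \<longleftrightarrow> k \<in> (\<Union>G' \<in> fset (options G). Suc ` terminal_lengths G')"
    by (cases k) (auto simp: zero_in_terminal_lengths Suc_in_terminal_lengths)
qed

lemma finite_terminal_lengths: "finite (terminal_lengths G)"
proof (induction G rule: game_option_induct)
  case (step G)
  then show ?case by (cases "G = 0") (simp_all add: terminal_lengths_rec)
qed

lemma terminal_lengths_ne_empty: "terminal_lengths G \<noteq> {}"
proof (induction G rule: game_option_induct)
  case (step G)
  show ?case
  proof (cases "G = 0")
    case False
    then obtain G' where "G' |\<in>| options G" using options_eq_empty_iff by blast
    with step False show ?thesis by (auto simp: terminal_lengths_rec)
  qed simp
qed

lemma card_terminal_lengths_pos: "card (terminal_lengths G) > 0"
  by (simp add: card_gt_0_iff finite_terminal_lengths terminal_lengths_ne_empty)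

text \<open>Play a terminal run of \<open>G\<close> to its end, then one of
  \<open>H\<close>.\<close>

lemma terminal_lengths_plusI:
  "a \<in> terminal_lengths G \<Longrightarrow> b \<in> terminal_lengths H \<Longrightarrow> a + b \<in> terminal_lengths (G + H)"
proof (induction a arbitrary: G)
  case 0
  then show ?case by (simp add: zero_in_terminal_lengths)
next
  case (Suc a)
  then obtain G' where "G' |\<in>| options G" "a \<in> terminal_lengths G'"
    by (auto simp: Suc_in_terminal_lengths)
  with Suc show ?case by (auto simp: Suc_in_terminal_lengths options_plus)
qed

lemma terminal_lengths_plusD:
  assumes "k \<in> terminal_lengths (G + H)"
  shows "\<exists>a \<in> terminal_lengths G. \<exists>b \<in> terminal_lengths H. k = a + b"
  using assms
proof (induction k arbitrary: G H)
  case 0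
  then show ?case by (auto simp: zero_in_terminal_lengths)
next
  case (Suc k)
  then obtain X where X: "X |\<in>| options (G + H)" "k \<in> terminal_lengths X"
    by (auto simp: Suc_in_terminal_lengths)
  from X(1) consider G' where "G' |\<in>| options G" "X = G' + H" | H' where "H' |\<in>| options H" "X = G + H'"
    by (auto simp: options_plus)
  then show ?case
  proof cases
    case 1
    then obtain a b where ab: "a \<in> terminal_lengths G'" "b \<in> terminal_lengths H" "k = a + b"
      using Suc.IH X(2) by metis
    have "Suc a \<in> terminal_lengths G" using 1(1) ab(1) Suc_in_terminal_lengths by blast
    with ab show ?thesis by (metis add_Suc)
  next
    case 2
    then obtain a b where ab: "a \<in> terminal_lengths G" "b \<in> terminal_lengths H'" "k = a + b"
      using Suc.IH X(2) by metis
    have "Suc b \<in> terminal_lengths H" using 2(1) ab(2) Suc_in_terminal_lengths by blast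
    with ab show ?thesis by (metis add_Suc_right)
  qed
qed

text \<open>Each move of the run is answered in \<open>H\<close> by a move to a smaller option, and
  both sides reach zero at the same time. The smaller game thus has the larger set of
  lengths.\<close>

lemma terminal_lengths_mono:
  assumes "left_dead_end G" "left_dead_end H" "G \<succeq> H"
  shows "terminal_lengths G \<subseteq> terminal_lengths H"
proof
  fix k assume "k \<in> terminal_lengths G"
  then show "k \<in> terminal_lengths H" using assms
  proof (induction k arbitrary: G H)
    case 0
    then show ?case using game_ge_zero_iff zero_in_terminal_lengths by blast
  next
    case (Suc k)
    then obtain G' where G': "G' |\<in>| options G" "k \<in> terminal_lengths G'"
      by (auto simp: Suc_in_terminal_lengths)
    obtain H' where H': "H' |\<in>| options H" "G' \<succeq> H'"
      using game_ge_option[OF Suc.prems(2-4) G'(1)] .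
    have "k \<in> terminal_lengths H'"
      using Suc.IH[OF G'(2) left_dead_end_option[OF Suc.prems(2) G'(1)]
          left_dead_end_option[OF Suc.prems(3) H'(1)] H'(2)] .
    with H'(1) show ?case by (auto simp: Suc_in_terminal_lengths)
  qed
qed

lemma terminal_lengths_eq:
  "left_dead_end G \<Longrightarrow> left_dead_end H \<Longrightarrow> G \<approx> H \<Longrightarrow> terminal_lengths G = terminal_lengths H"
  unfolding game_eq_def using terminal_lengths_mono by blast

lemma race_in: "race G \<in> terminal_lengths G"
  by (simp add: race_def finite_terminal_lengths terminal_lengths_ne_empty)

lemma race_le: "k \<in> terminal_lengths G \<Longrightarrow> race G \<le> k"
  by (simp add: race_def finite_terminal_lengths)

lemma race_plus: "race (G + H) = race G + race H"
proof (rule antisym)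
  show "race (G + H) \<le> race G + race H"
    by (intro race_le terminal_lengths_plusI race_in)
  obtain a b where "a \<in> terminal_lengths G" "b \<in> terminal_lengths H" "race (G + H) = a + b"
    using terminal_lengths_plusD[OF race_in] by blast
  then show "race G + race H \<le> race (G + H)"
    using race_le by (simp add: add_mono)
qed

lemma race_eq: "left_dead_end G \<Longrightarrow> left_dead_end H \<Longrightarrow> G \<approx> H \<Longrightarrow> race G = race H"
  unfolding race_def using terminal_lengths_eq by presburger

lemma race_pos: "G \<noteq> 0 \<Longrightarrow> race G > 0"
  using race_in[of G] zero_in_terminal_lengths[of G] by (cases "race G") simp_all

text \<open>Translate \<open>A\<close> by \<open>Min B\<close> and \<open>B\<close> by
  \<open>Max A\<close>. The first translate lies at or below \<open>Max A + Min B\<close> and the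
  second at or above it, so they share at most this point.\<close>

lemma card_sumset_ge:
  fixes A B C :: "nat set"
  assumes fin: "finite A" "finite B" "finite C" and ne: "A \<noteq> {}" "B \<noteq> {}"
    and sums: "\<And>a b. a \<in> A \<Longrightarrow> b \<in> B \<Longrightarrow> a + b \<in> C"
  shows "card A + card B \<le> card C + 1"
proof -
  define A' where "A' = (\<lambda>a. a + Min B) ` A"
  define B' where "B' = (\<lambda>b. Max A + b) ` B"
  have "A' \<inter> B' \<subseteq> {Max A + Min B}"
  proof
    fix x assume "x \<in> A' \<inter> B'"
    then obtain a b where x: "a \<in> A" "b \<in> B" "x = a + Min B" "x = Max A + b"
      by (auto simp: A'_def B'_def)
    with fin have "a \<le> Max A" "Min B \<le> b" by simp_all
    with x show "x \<in> {Max A + Min B}" by simp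
  qed
  then have "card (A' \<inter> B') \<le> 1" using card_mono[of "{Max A + Min B}"] by simp
  moreover have "card A' = card A" "card B' = card B"
    by (simp_all add: A'_def B'_def card_image)
  moreover have "card A' + card B' = card (A' \<union> B') + card (A' \<inter> B')"
    using fin by (intro card_Un_Int) (simp_all add: A'_def B'_def)
  moreover have "A' \<union> B' \<subseteq> C"
    using sums Max_in[OF fin(1) ne(1)] Min_in[OF fin(2) ne(2)] by (auto simp: A'_def B'_def)
  then have "card (A' \<union> B') \<le> card C" using fin(3) by (intro card_mono)
  ultimately show ?thesis by presburger
qed

lemma card_terminal_lengths_plus:
  "card (terminal_lengths G) + card (terminal_lengths H) \<le> card (terminal_lengths (G + H)) + 1"
  by (intro card_sumset_ge finite_terminal_lengths terminal_lengths_ne_empty terminal_lengths_plusI)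


subsection \<open>Integers\<close>

lemma terminal_lengths_integer_game: "terminal_lengths (integer_game n) = {n}"
  by (induction n) (simp_all add: terminal_lengths_rec)

text \<open>Every option has \<open>n\<close> as its only terminal length, so by induction it is the
  form \<open>integer_game n\<close>. All options being identical, there is just one.\<close>

lemma terminal_lengths_singleton_imp_integer:
  assumes "left_dead_end G" "terminal_lengths G = {n}"
  shows "G = integer_game n"
  using assms
proof (induction n arbitrary: G)
  case 0
  then show ?case by (metis insertI1 integer_game.simps(1) zero_in_terminal_lengths)
next
  case (Suc n)
  have "0 \<notin> terminal_lengths G" by (simp add: Suc.prems)
  then have "G \<noteq> 0" by (simp add: zero_in_terminal_lengths)
  have opt: "G' = integer_game n" if "G' |\<in>| right_opts G" for G'
  proof (rule Suc.IH)
    have G': "G' |\<in>| options G" using that by (simp add: options_def)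
    then show "left_dead_end G'" using Suc.prems left_dead_end_option by blast
    have "Suc ` terminal_lengths G' \<subseteq> {Suc n}"
      using G' \<open>G \<noteq> 0\<close> Suc.prems(2) by (auto simp: terminal_lengths_rec)
    then show "terminal_lengths G' = {n}"
      using terminal_lengths_ne_empty[of G'] by auto
  qed
  have "right_opts G \<noteq> {||}"
    using \<open>G \<noteq> 0\<close> Suc.prems(1) by (simp add: left_dead_end_right_opts options_eq_empty_iff)
  then obtain X where "X |\<in>| right_opts G" by blast
  with opt have "right_opts G = {|integer_game n|}" by (intro fset_eqI) (metis fsingleton_iff)
  moreover have "left_opts G = {||}" using Suc.prems(1) by (rule left_dead_end_left_opts)
  ultimately show ?case by (intro game.expand) simp
qed

text \<open>Being an integer is defined by the form; this turns it into a property of the terminal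
  lengths, which can be compared along the order.\<close>

lemma is_integer_iff:
  assumes "left_dead_end G"
  shows "is_integer G \<longleftrightarrow> card (terminal_lengths G) = 1"
proof
  assume "is_integer G"
  then obtain n where "G = integer_game n" unfolding is_integer_def ..
  then show "card (terminal_lengths G) = 1" by (simp add: terminal_lengths_integer_game)
next
  assume "card (terminal_lengths G) = 1"
  then obtain n where "terminal_lengths G = {n}" by (rule card_1_singletonE)
  then show "is_integer G"
    using terminal_lengths_singleton_imp_integer[OF assms] unfolding is_integer_def by blast
qed

lemma not_is_integer_iff:
  assumes "left_dead_end G"
  shows "\<not> is_integer G \<longleftrightarrow> card (terminal_lengths G) \<ge> 2"
  unfolding is_integer_iff[OF assms] using card_terminal_lengths_pos[of G] by linarith

text \<open>An identity of forms: by induction the two options of the sum coincide.\<close>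

lemma integer_game_Suc_eq: "integer_game (Suc n) = integer_game 1 + integer_game n"
proof (induction n)
  case (Suc n)
  have "right_opts (integer_game 1 + integer_game (Suc n)) =
      {|integer_game (Suc n), integer_game 1 + integer_game n|}"
    by (simp add: right_opts_plus finsert_commute)
  also have "\<dots> = right_opts (integer_game (Suc (Suc n)))"
    unfolding Suc.IH[symmetric] by simp
  finally show ?case
    by (intro game.expand) (simp add: left_opts_plus)
qed simp

lemma is_integer_plusD:
  assumes "left_dead_end G" "left_dead_end H" "is_integer (G + H)"
  shows "is_integer H"
proof -
  have "card (terminal_lengths (G + H)) = 1"
    using assms is_integer_iff left_dead_end_plus by blast
  then have "card (terminal_lengths H) = 1"
    using card_terminal_lengths_plus[of G H] card_terminal_lengths_pos[of G]
      card_terminal_lengths_pos[of H] by linarith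
  then show ?thesis using assms(2) is_integer_iff by blast
qed

lemma is_integer_mono:
  assumes "left_dead_end G" "left_dead_end H" "G \<succeq> H" "is_integer H"
  shows "is_integer G"
proof -
  have "card (terminal_lengths G) \<le> card (terminal_lengths H)"
    using assms finite_terminal_lengths by (intro card_mono terminal_lengths_mono)
  then show ?thesis
    using assms card_terminal_lengths_pos[of G] by (simp add: is_integer_iff)
qed


subsection \<open>Flexibility\<close>

lemma flex_integer: "is_integer G \<Longrightarrow> flex G = 0"
  by (subst flex.simps) simp

lemma not_is_integer_ne_zero: "\<not> is_integer G \<Longrightarrow> G \<noteq> 0"
  unfolding is_integer_def by (metis integer_game.simps(1))

lemma flex_option:
  assumes "\<not> is_integer G" "G' |\<in>| options G"
  shows "flex G' + 1 \<le> flex G"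
proof -
  have "flex G' \<le> Max (flex ` fset (options G))" using assms(2) by (intro Max_ge) simp_all
  then show ?thesis using assms(1) by (simp add: flex.simps[of G])
qed

lemma flex_attained:
  assumes "\<not> is_integer G"
  obtains G' where "G' |\<in>| options G" "flex G = flex G' + 1"
proof -
  have "flex ` fset (options G) \<noteq> {}"
    using options_eq_empty_iff[of G] not_is_integer_ne_zero[OF assms] by auto
  then have "Max (flex ` fset (options G)) \<in> flex ` fset (options G)" by (intro Max_in) simp
  then obtain G' where "G' |\<in>| options G" "Max (flex ` fset (options G)) = flex G'" by auto
  with that assms show ?thesis by (simp add: flex.simps[of G])
qed

text \<open>Follow an option of \<open>G\<close> of greatest flexibility and mirror it in
  \<open>H\<close>. As long as \<open>G\<close> is not an integer, neither is \<open>H\<close>, so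
  each step counts on both sides.\<close>

lemma flex_mono:
  assumes "left_dead_end G" "left_dead_end H" "G \<succeq> H"
  shows "flex G \<le> flex H"
  using assms
proof (induction G arbitrary: H rule: game_option_induct)
  case (step G)
  show ?case
  proof (cases "is_integer G")
    case False
    then obtain G' where G': "G' |\<in>| options G" "flex G = flex G' + 1" by (rule flex_attained)
    then obtain H' where H': "H' |\<in>| options H" "G' \<succeq> H'"
      using step.prems game_ge_option by metis
    then have "flex G' \<le> flex H'"
      using step G' left_dead_end_option by blast
    moreover have "flex H' + 1 \<le> flex H"
      using False H' step.prems is_integer_mono by (intro flex_option) blast
    ultimately show ?thesis using G' by simp
  qed (simp add: flex_integer)
qed

text \<open>Play all of \<open>G\<close> first: the position stays a non-integer because \<open>H\<close> is one.\<close>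

lemma flex_plus_ge:
  assumes "k \<in> terminal_lengths G" "left_dead_end G" "left_dead_end H" "\<not> is_integer H"
  shows "k + flex H \<le> flex (G + H)"
  using assms
proof (induction k arbitrary: G)
  case 0
  then show ?case by (simp add: zero_in_terminal_lengths)
next
  case (Suc k)
  then obtain G' where G': "G' |\<in>| options G" "k \<in> terminal_lengths G'"
    by (auto simp: Suc_in_terminal_lengths)
  then have "k + flex H \<le> flex (G' + H)"
    using Suc left_dead_end_option by blast
  moreover have "flex (G' + H) + 1 \<le> flex (G + H)"
    using G' Suc.prems is_integer_plusD by (intro flex_option) (auto simp: options_plus)
  ultimately show ?case by simp
qed

text \<open>There are at least two terminal lengths, and \<open>0\<close> is not among them because
  \<open>G\<close> is nonzero.\<close>

lemma ex_terminal_length_ge_2: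
  assumes "left_dead_end G" "\<not> is_integer G"
  obtains k where "k \<in> terminal_lengths G" "k \<ge> 2"
proof -
  have "\<not> terminal_lengths G \<subseteq> {1}"
    using card_mono[of "{1}" "terminal_lengths G"] not_is_integer_iff[OF assms(1)] assms(2) by auto
  then obtain k where k: "k \<in> terminal_lengths G" "k \<noteq> 1" by blast
  moreover have "k \<noteq> 0"
    using k(1) not_is_integer_ne_zero[OF assms(2)] zero_in_terminal_lengths by metis
  ultimately show ?thesis by (intro that[of k]) simp_all
qed


subsection \<open>Factorisations\<close>

lemma atom_left_dead_end: "atom A \<Longrightarrow> left_dead_end A"
  by (simp add: atom_def)

lemma atom_ne_zero: "atom A \<Longrightarrow> A \<noteq> 0"
  by (auto simp: atom_def)

text \<open>A positive integer splits off a summand \<open>1\<close>, which is nonzero, so atomicity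
  forces the rest to vanish.\<close>

lemma atom_integer:
  assumes "atom A" "is_integer A"
  shows "A = integer_game 1"
proof -
  obtain n where n: "A = integer_game n" using assms(2) by (auto simp: is_integer_def)
  then obtain m where m: "n = Suc m" using atom_ne_zero[OF assms(1)] by (cases n) auto
  have "A \<approx> integer_game 1 + integer_game m" by (simp only: n m integer_game_Suc_eq game_eq_refl)
  then have "integer_game 1 \<approx> 0 \<or> integer_game m \<approx> 0"
    using assms(1) left_dead_end_integer_game unfolding atom_def by blast
  moreover have "integer_game 1 \<noteq> 0" by simp
  ultimately have "integer_game m = 0" by (simp add: game_eq_zero_iff left_dead_end_integer_game)
  then have "m = 0" by (cases m) auto
  with n m show ?thesis by simp
qed

lemma factorisation_dead_end:
  "is_factorisation As G \<Longrightarrow> left_dead_end (sum_list As)"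
  by (auto simp: is_factorisation_def intro: left_dead_end_sum_list atom_left_dead_end)

lemma length_le_race_sum_list:
  "(\<And>A. A \<in> set As \<Longrightarrow> atom A) \<Longrightarrow> length As \<le> race (sum_list As)"
proof (induction As)
  case (Cons A As)
  have "race A > 0"
    by (intro race_pos atom_ne_zero Cons.prems) simp
  moreover have "length As \<le> race (sum_list As)"
    by (intro Cons.IH Cons.prems) simp
  ultimately show ?case by (simp add: race_plus)
qed simp

lemma factorisation_length_le_race:
  assumes "left_dead_end G" "is_factorisation As G"
  shows "length As \<le> race G"
proof -
  have "race G = race (sum_list As)"
    using assms factorisation_dead_end by (intro race_eq) (auto simp: is_factorisation_def)
  then show ?thesis
    using assms(2) length_le_race_sum_list[of As] by (simp add: is_factorisation_def)
qed

lemma is_factorisation_append: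
  "is_factorisation As G \<Longrightarrow> is_factorisation Bs H \<Longrightarrow> is_factorisation (As @ Bs) (G + H)"
  by (auto simp: is_factorisation_def intro: game_eq_plus)

lemma is_factorisation_eq:
  "is_factorisation As G \<Longrightarrow> H \<approx> G \<Longrightarrow> is_factorisation As H"
  by (auto simp: is_factorisation_def intro: game_eq_trans)

text \<open>Race is additive, invariant under equality and positive on nonzero games, so both parts
  of a proper splitting have smaller race.\<close>

lemma ex_factorisation:
  assumes "left_dead_end G"
  shows "\<exists>As. is_factorisation As G"
  using assms
proof (induction "race G" arbitrary: G rule: less_induct)
  case less
  consider "G = 0" | "atom G" | "G \<noteq> 0" "\<not> atom G" by blast
  then show ?case
  proof cases
    case 1
    then have "is_factorisation [] G" by (simp add: is_factorisation_def)
    then show ?thesis ..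
  next
    case 2
    then have "is_factorisation [G] G" by (simp add: is_factorisation_def)
    then show ?thesis ..
  next
    case 3
    then obtain H K where HK: "left_dead_end H" "left_dead_end K" "G \<approx> H + K" "H \<noteq> 0" "K \<noteq> 0"
      using less.prems by (auto simp: atom_def game_eq_zero_iff)
    then have "race G = race H + race K"
      using race_eq[OF less.prems left_dead_end_plus] by (simp add: race_plus)
    then have "race H < race G" "race K < race G"
      using HK race_pos by simp_all
    then obtain As Bs where "is_factorisation As H" "is_factorisation Bs K"
      using less.hyps HK(1,2) by metis
    then have "is_factorisation (As @ Bs) G"
      using is_factorisation_append is_factorisation_eq HK(3) by blast
    then show ?thesis ..
  qed
qed

lemma finite_factorisation_lengths:
  assumes "left_dead_end G"
  shows "finite {length As | As. is_factorisation As G}"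
proof (rule finite_subset)
  show "{length As | As. is_factorisation As G} \<subseteq> {..race G}"
    using factorisation_length_le_race[OF assms] by blast
qed simp

lemma length_le_factorisation_length:
  assumes "left_dead_end G" "is_factorisation As G"
  shows "length As \<le> \<ell> G"
  unfolding factorisation_length_def
  by (rule Max_ge[OF finite_factorisation_lengths[OF assms(1)]]) (use assms(2) in blast)

lemma factorisation_length_attained:
  assumes "left_dead_end G"
  obtains As where "is_factorisation As G" "length As = \<ell> G"
proof -
  have "\<ell> G \<in> {length As | As. is_factorisation As G}"
    unfolding factorisation_length_def
    by (rule Max_in[OF finite_factorisation_lengths[OF assms]]) (use ex_factorisation[OF assms] in blast)
  then obtain As where "\<ell> G = length As" "is_factorisation As G" by blast
  then show ?thesis by (intro that) simp_all
qed

text \<open>A move replaces one atom by an option of it, whose own factorisation may be empty; the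
  other atoms survive. Hence at most one factor is lost.\<close>

lemma option_sum_list_factorisation:
  assumes "\<And>A. A \<in> set As \<Longrightarrow> atom A" "X |\<in>| options (sum_list As)"
  shows "\<exists>Bs. is_factorisation Bs X \<and> length As \<le> length Bs + 1"
  using assms
proof (induction As arbitrary: X)
  case (Cons A As)
  have As: "is_factorisation As (sum_list As)" and A: "is_factorisation [A] A"
    using Cons.prems(1) by (simp_all add: is_factorisation_def)
  from Cons.prems(2) consider A' where "A' |\<in>| options A" "X = A' + sum_list As"
    | Y where "Y |\<in>| options (sum_list As)" "X = A + Y"
    by (auto simp: options_plus)
  then show ?case
  proof cases
    case 1
    moreover have "left_dead_end A" using Cons.prems(1) by (simp add: atom_left_dead_end)
    ultimately obtain Bs where "is_factorisation Bs A'"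
      using ex_factorisation left_dead_end_option by blast
    then have "is_factorisation (Bs @ As) X"
      using is_factorisation_append As 1 by blast
    then show ?thesis by force
  next
    case 2
    then obtain Bs where "is_factorisation Bs Y" "length As \<le> length Bs + 1"
      using Cons by auto
    moreover from this have "is_factorisation ([A] @ Bs) X"
      using is_factorisation_append A 2 by blast
    ultimately show ?thesis by force
  qed
qed simp

lemma length_le_card_terminal_lengths:
  assumes "\<And>A. A \<in> set As \<Longrightarrow> left_dead_end A \<and> \<not> is_integer A"
  shows "length As + 1 \<le> card (terminal_lengths (sum_list As))"
  using assms
proof (induction As)
  case (Cons A As)
  have "card (terminal_lengths A) \<ge> 2"
    using Cons.prems[of A] not_is_integer_iff[of A] by simp
  moreover have "length As + 1 \<le> card (terminal_lengths (sum_list As))"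
    by (intro Cons.IH Cons.prems) simp
  ultimately show ?case using card_terminal_lengths_plus[of A "sum_list As"] by simp
qed simp

text \<open>The last summand contributes at least 1, being a non-integer, and each earlier one at
  least 2 by a run through it. This totals twice the length minus 1.\<close>

lemma length_le_flex:
  assumes "\<And>A. A \<in> set As \<Longrightarrow> left_dead_end A \<and> \<not> is_integer A" "As \<noteq> []"
  shows "2 * length As \<le> flex (sum_list As) + 1"
  using assms(2,1)
proof (induction As rule: list_nonempty_induct)
  case (single A)
  then have "\<not> is_integer A" by simp
  then obtain A' where "flex A = flex A' + 1" by (rule flex_attained)
  then show ?case by simp
next
  case (cons A As)
  let ?S = "sum_list As"
  have A: "left_dead_end A" "\<not> is_integer A" using cons.prems by simp_all
  then obtain k where k: "k \<in> terminal_lengths A" "k \<ge> 2" by (rule ex_terminal_length_ge_2)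
  have S: "left_dead_end ?S" using cons.prems by (intro left_dead_end_sum_list) simp
  have "length As + 1 \<le> card (terminal_lengths ?S)"
    using cons.prems by (intro length_le_card_terminal_lengths) simp
  moreover have "length As \<ge> 1" using cons.hyps(1) by (cases As) simp_all
  \<comment> \<open>The remaining sum has at least two terminal lengths, as
    \<open>flex_plus_ge\<close> needs a non-integer to stay behind.\<close>
  ultimately have "\<not> is_integer ?S" by (simp add: not_is_integer_iff[OF S])
  then have "k + flex ?S \<le> flex (A + ?S)"
    using flex_plus_ge k A S by blast
  with k cons show ?case by simp
qed

lemma factorisation_not_integer:
  assumes "left_dead_end G" "more_than_one_good_option G" "is_factorisation As G" "A \<in> set As"
  shows "\<not> is_integer A"
proof
  assume "is_integer A"
  then have A: "A = integer_game 1"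
    using assms(3,4) atom_integer by (auto simp: is_factorisation_def)
  \<comment> \<open>Only one occurrence of the atom \<open>1\<close> is removed; \<open>H\<close>
    may contain further copies.\<close>
  define H where "H = sum_list (remove1 A As)"
  have "left_dead_end H"
    using assms(3) set_remove1_subset[of A As] unfolding H_def is_factorisation_def
    by (intro left_dead_end_sum_list) (auto intro: atom_left_dead_end)
  moreover have "sum_list As = integer_game 1 + H"
    using assms(4) by (simp only: H_def A sum_list_map_remove1[of A As id, simplified])
  moreover have "more_than_one_good_option (sum_list As)"
    using more_than_one_good_option_eq[OF assms(1) factorisation_dead_end] assms(2,3)
    by (auto simp: is_factorisation_def)
  ultimately show False using not_more_than_one_good_option_one_plus by simp
qed

section \<open>Assembling the four bounds from one longest factorisation\<close>

theorem mainTheorem15: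
  fixes G :: game
  assumes "left_dead_end G"
    and "more_than_one_good_option G"
  shows "real (\<ell> G) \<le>
    Min ({real (race G)}
      \<union> {real (\<ell> G') + 1 | G'. good_option G' G}
      \<union> {real (card (terminal_lengths G)) - 1}
      \<union> {(real (flex G) + 1) / 2})"
proof -
  obtain As where As: "is_factorisation As G" and len: "length As = \<ell> G"
    using factorisation_length_attained[OF assms(1)] .
  let ?S = "sum_list As"
  have S: "left_dead_end ?S" using As by (rule factorisation_dead_end)
  have eq: "G \<approx> ?S" and atoms: "\<And>A. A \<in> set As \<Longrightarrow> atom A"
    using As by (simp_all add: is_factorisation_def)
  have nonint: "left_dead_end A \<and> \<not> is_integer A" if "A \<in> set As" for A
    using factorisation_not_integer[OF assms As] atoms atom_left_dead_end that by blast
  have "\<ell> G \<le> race G"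
    using factorisation_length_le_race[OF assms(1) As] len by simp
  moreover have "real (\<ell> G) \<le> real (\<ell> G') + 1" if good: "good_option G' G" for G'
  proof -
    \<comment> \<open>\<open>G\<close> merely equals the sum of its atoms, so \<open>G'\<close> is
      first traded for an equal option of that sum, whose shape is known.\<close>
    obtain X where "good_option X ?S" "G' \<approx> X" using good_option_eq[OF assms(1) S eq good] .
    moreover from this obtain Bs where "is_factorisation Bs X" "length As \<le> length Bs + 1"
      using option_sum_list_factorisation[OF atoms] good_option_option by blast
    moreover have "left_dead_end G'"
      using good assms(1) good_option_option left_dead_end_option by blast
    ultimately show ?thesis
      using length_le_factorisation_length[of G' Bs] is_factorisation_eq len by fastforce
  qed
  moreover have "\<ell> G + 1 \<le> card (terminal_lengths G)"
    using length_le_card_terminal_lengths[of As] nonint len terminal_lengths_eq[OF assms(1) S eq]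
    by simp
  moreover have "2 * \<ell> G \<le> flex G + 1"
  proof (cases "As = []")
    case False
    have "flex ?S \<le> flex G" using flex_mono S assms(1) eq by (simp add: game_eq_def)
    with False show ?thesis using length_le_flex[of As] nonint len by fastforce
  qed (use len in simp)
  \<comment> \<open>Bounding \<open>Min\<close> from below requires the set of bounds to be
    finite.\<close>
  moreover have "finite {G'. good_option G' G}"
    by (rule finite_subset[of _ "fset (options G)"]) (auto dest: good_option_option)
  then have "finite {real (\<ell> G') + 1 | G'. good_option G' G}" by simp
  ultimately show ?thesis
    by (intro Min.boundedI) (auto simp: field_simps)
qed

end
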